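(* Let $\mathbb{E}_1,\mathbb{E}_2$ be Euclidean spaces and let $D\subset\mathbb{E}_1$ be nonempty and convex. Then $F:D\to\mathbb{E}_2$ is $\{0\}$-convex if and only if there exists an affine function $G:\mathrm{aff}\,D\to\mathbb{E}_2$ such that $F=G_{|D}$.
   Context: A Euclidean space is a finite-dimensional real inner product space. For a cone $K\subset\mathbb{E}_2$ (a nonempty set closed under multiplication by all $\lambda\ge0$) and $F:D\to\mathbb{E}_2$, the $K$-epigraph is $K\text{-}\mathrm{epi}\,F:=\{(x,y)\in D\times\mathbb{E}_2 : y-F(x)\in K\}$, and $F$ is $K$-convex if $K\text{-}\mathrm{epi}\,F$ is convex; $\{0\}$-convexity is the case $K=\{0\}$. $\mathrm{aff}\,D$ is the affine hull of $D$. For a nonempty affine set $A\subset\mathbb{E}_1$ and $x_0\in A$, $\mathrm{par}\,A:=A-x_0$ is the subspace parallel to $A$, and $G:A\to\mathbb{E}_2$ is called affine if there are a linear map $L:\mathrm{par}\,A\to\mathbb{E}_2$ and $b\in\mathbb{E}_2$ with $G(x)=L(x-x_0)+b$ for all $x\in A$. *)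

theory Defs
  imports "HOL-Analysis.Analysis"
begin

text \<open>
  A Euclidean space is rendered as a type of class \<open>real_inner\<close> that is finite-dimensional in the
  sense below. The library class \<open>euclidean_space\<close> is not used because it requires a nonempty
  basis and hence excludes the zero space.
\<close>

definition finite_dimensional :: "'a::real_vector itself \<Rightarrow> bool" where
  "finite_dimensional _ \<longleftrightarrow>
     (\<exists>B :: 'a set. finite_dimensional_vector_space (scaleR :: real \<Rightarrow> 'a \<Rightarrow> 'a) B)"

lemma finite_dimensional_euclidean_space: "finite_dimensional TYPE('a::euclidean_space)"
  unfolding finite_dimensional_def
  using eucl.finite_dimensional_vector_space_axioms by blast

text \<open>
  A function with domain \<open>D\<close> is a total HOL function of which only the values on \<open>D\<close> matter. The
  set \<open>K\<close> is meant to be a nonempty cone; the definitions make sense for every set.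
\<close>

definition K_epi :: "'b::real_vector set \<Rightarrow> 'a::real_vector set \<Rightarrow> ('a \<Rightarrow> 'b) \<Rightarrow> ('a \<times> 'b) set" where
  "K_epi K D F = {(x, y). x \<in> D \<and> y - F x \<in> K}"

definition K_convex_on :: "'b::real_vector set \<Rightarrow> 'a::real_vector set \<Rightarrow> ('a \<Rightarrow> 'b) \<Rightarrow> bool" where
  "K_convex_on K D F \<longleftrightarrow> convex (K_epi K D F)"

definition par :: "'a::real_vector set \<Rightarrow> 'a \<Rightarrow> 'a set" where
  "par A x0 = (\<lambda>x. x - x0) ` A"

text \<open>The library's \<open>linear\<close> only speaks about maps on a whole type; here \<open>V\<close> is a subspace.\<close>

definition linear_map_on :: "'a::real_vector set \<Rightarrow> ('a \<Rightarrow> 'b::real_vector) \<Rightarrow> bool" where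
  "linear_map_on V L \<longleftrightarrow>
     (\<forall>u\<in>V. \<forall>v\<in>V. L (u + v) = L u + L v) \<and> (\<forall>c. \<forall>v\<in>V. L (c *\<^sub>R v) = c *\<^sub>R L v)"

definition affine_map_at :: "'a::real_vector set \<Rightarrow> 'a \<Rightarrow> ('a \<Rightarrow> 'b::real_vector) \<Rightarrow> bool" where
  "affine_map_at A x0 G \<longleftrightarrow>
     (\<exists>L b. linear_map_on (par A x0) L \<and> (\<forall>x\<in>A. G x = L (x - x0) + b))"

definition affine_map_on :: "'a::real_vector set \<Rightarrow> ('a \<Rightarrow> 'b::real_vector) \<Rightarrow> bool" where
  "affine_map_on A G \<longleftrightarrow> affine A \<and> (\<exists>x0\<in>A. affine_map_at A x0 G)"

text \<open>Neither the parallel subspace nor affinity depends on the base point.\<close>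

lemma subspace_par:
  assumes "affine A" "x0 \<in> A"
  shows "subspace (par A x0)"
  using affine_diffs_subspace_subtract[OF assms] by (simp add: par_def)

lemma par_eq:
  assumes "affine A" "x0 \<in> A" "x1 \<in> A"
  shows "par A x1 = par A x0"
proof -
  have *: "par A p \<subseteq> par A q" if "p \<in> A" "q \<in> A" for p q
  proof
    fix v assume "v \<in> par A p"
    then obtain x where x: "x \<in> A" "v = x - p" by (auto simp: par_def)
    have "x - q \<in> par A q" "p - q \<in> par A q" using x that by (auto simp: par_def)
    then have "(x - q) - (p - q) \<in> par A q"
      by (rule subspace_diff[OF subspace_par[OF assms(1) that(2)]])
    then show "v \<in> par A q" by (simp add: x)
  qed
  show ?thesis using *[of x0 x1] *[of x1 x0] assms by blast
qed

lemma affine_map_on_iff: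
  assumes "affine A" "x0 \<in> A"
  shows "affine_map_on A G \<longleftrightarrow> affine_map_at A x0 G"
proof
  assume "affine_map_on A G"
  then obtain x1 L b where x1: "x1 \<in> A" and L: "linear_map_on (par A x1) L"
    and G: "\<And>x. x \<in> A \<Longrightarrow> G x = L (x - x1) + b"
    unfolding affine_map_on_def affine_map_at_def by blast
  have P: "par A x1 = par A x0" by (rule par_eq[OF assms x1])
  have "G x = L (x - x0) + (L (x0 - x1) + b)" if "x \<in> A" for x
  proof -
    have "x - x0 \<in> par A x1" using that unfolding P by (simp add: par_def)
    moreover have "x0 - x1 \<in> par A x1" using assms(2) by (simp add: par_def)
    ultimately have "L ((x - x0) + (x0 - x1)) = L (x - x0) + L (x0 - x1)"
      using L unfolding linear_map_on_def by blast
    then show ?thesis using G[OF that] by (simp add: add.assoc)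
  qed
  then show "affine_map_at A x0 G"
    using L unfolding P affine_map_at_def by blast
next
  assume "affine_map_at A x0 G"
  then show "affine_map_on A G" using assms unfolding affine_map_on_def by blast
qed

end

theory Submission
  imports Defs
begin

text \<open>
  The set \<open>K_epi {0} D F\<close> is the graph of \<open>F\<close> over \<open>D\<close>, and a function is affine exactly when its
  graph over an affine set is affine. So the extension of \<open>F\<close> is read off from the affine hull of
  its graph. That this hull projects onto the affine hull of \<open>D\<close> is clear, because the projection
  is linear; the point is that no two of its elements lie over the same \<open>x\<close>.

  This is lemma \<open>inj_on_affine_hull\<close>: a linear map that is injective on a convex set \<open>S\<close> is
  injective on the affine hull of \<open>S\<close>. Convexity enters because every point of the hull is an
  extrapolation \<open>(1 + t) u - t v\<close> along one segment of \<open>S\<close>. If two extrapolations have the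
  same image, then moving the negative terms to the other side and dividing by the total weight
  turns this into an equality of the images of two convex combinations, which are points of \<open>S\<close>.

  Conversely, an affine map sends convex combinations to convex combinations, so its graph over a
  convex set is convex.
\<close>

text \<open>
  Clearing denominators in a convex combination: this form also covers total weight \<open>0\<close>, so signed
  combinations can be regrouped below without dividing.
\<close>

lemma convex_nonneg_combination:
  fixes S :: "'a::real_vector set"
  assumes "convex S" "u \<in> S" "v \<in> S" "0 \<le> a" "0 \<le> b"
  obtains w where "w \<in> S" "a *\<^sub>R u + b *\<^sub>R v = (a + b) *\<^sub>R w"
proof (cases "a + b = 0")
  case True
  then have "a = 0" "b = 0" using assms by auto
  then show ?thesis using that[of u] assms by simp
next
  case False
  let ?w = "(a / (a + b)) *\<^sub>R u + (b / (a + b)) *\<^sub>R v"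
  have "?w \<in> S"
    using assms False by (intro convexD) (auto simp: add_divide_distrib[symmetric])
  moreover have "a *\<^sub>R u + b *\<^sub>R v = (a + b) *\<^sub>R ?w"
    using False by (simp add: scaleR_add_right)
  ultimately show ?thesis by (rule that)
qed

text \<open>
  The extrapolations along segments of \<open>S\<close> already form an affine set: in an affine combination of
  two of them, collect the terms with nonnegative and those with negative weight and replace each
  group by a single point of \<open>S\<close>.
\<close>

lemma affine_hull_convex_extrapolation:
  fixes S :: "'a::real_vector set"
  assumes "convex S" "p \<in> affine hull S"
  obtains u v t where "u \<in> S" "v \<in> S" "0 \<le> t" "p = (1 + t) *\<^sub>R u - t *\<^sub>R v"
proof -
  define E where "E = {p. \<exists>u\<in>S. \<exists>v\<in>S. \<exists>t\<ge>0. p = (1 + t) *\<^sub>R u - t *\<^sub>R v}"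
  have regroup: "p \<in> E"
    if S: "u1 \<in> S" "u2 \<in> S" "v1 \<in> S" "v2 \<in> S"
      and nn: "0 \<le> a1" "0 \<le> a2" "0 \<le> b1" "0 \<le> b2" and total: "a1 + a2 = 1 + (b1 + b2)"
      and p: "p = (a1 *\<^sub>R u1 + a2 *\<^sub>R u2) - (b1 *\<^sub>R v1 + b2 *\<^sub>R v2)"
    for p u1 u2 v1 v2 a1 a2 b1 b2
  proof -
    obtain u where u: "u \<in> S" "a1 *\<^sub>R u1 + a2 *\<^sub>R u2 = (a1 + a2) *\<^sub>R u"
      using convex_nonneg_combination[OF assms(1) S(1,2) nn(1,2)] .
    obtain v where v: "v \<in> S" "b1 *\<^sub>R v1 + b2 *\<^sub>R v2 = (b1 + b2) *\<^sub>R v"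
      using convex_nonneg_combination[OF assms(1) S(3,4) nn(3,4)] .
    have "p = (1 + (b1 + b2)) *\<^sub>R u - (b1 + b2) *\<^sub>R v"
      using p u(2) v(2) total by simp
    then show ?thesis
      unfolding E_def using u(1) v(1) nn by (auto intro!: bexI exI[of _ "b1 + b2"])
  qed
  have mix: "a *\<^sub>R p + b *\<^sub>R q \<in> E"
    if "p \<in> E" "q \<in> E" and ab: "a + b = 1" "0 \<le> a" for p q a b
  proof -
    obtain u v t where p: "u \<in> S" "v \<in> S" "0 \<le> t" "p = (1 + t) *\<^sub>R u - t *\<^sub>R v"
      using \<open>p \<in> E\<close> unfolding E_def by blast
    obtain u' v' s where q: "u' \<in> S" "v' \<in> S" "0 \<le> s" "q = (1 + s) *\<^sub>R u' - s *\<^sub>R v'"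
      using \<open>q \<in> E\<close> unfolding E_def by blast
    show ?thesis
    proof (cases "0 \<le> b")
      case True
      show ?thesis
        by (rule regroup[of u u' v v' "a * (1 + t)" "b * (1 + s)" "a * t" "b * s"])
          (use p(1-3) q(1-3) ab True in \<open>simp_all add: p(4) q(4) algebra_simps\<close>)
    next
      case False
      \<comment> \<open>A negative \<open>b\<close> exchanges the roles of \<open>u'\<close> and \<open>v'\<close>.\<close>
      then have "0 \<le> - b * s" "0 \<le> - b * (1 + s)"
        using q(3) by (simp_all add: mult_nonpos_nonneg)
      then show ?thesis
        by (intro regroup[of u v' v u' "a * (1 + t)" "- b * s" "a * t" "- b * (1 + s)"])
          (use p(1-3) q(1-3) ab in \<open>simp_all add: p(4) q(4) algebra_simps\<close>)
    qed
  qed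
  have "affine E"
    unfolding affine_def
  proof (intro ballI allI impI)
    fix p q a b
    assume pq: "p \<in> E" "q \<in> E" and ab: "a + b = (1::real)"
    \<comment> \<open>Two weights with sum \<open>1\<close> are not both negative.\<close>
    then consider "0 \<le> a" | "0 \<le> b" by linarith
    then show "a *\<^sub>R p + b *\<^sub>R q \<in> E"
      using mix[OF pq ab] mix[OF pq(2,1), of b a] ab by cases (simp_all add: add.commute)
  qed
  moreover have "S \<subseteq> E"
    unfolding E_def by (auto intro!: bexI exI[of _ 0])
  ultimately have "affine hull S \<subseteq> E" by (rule hull_minimal[rotated])
  then show ?thesis using assms(2) that unfolding E_def by blast
qed

text \<open>
  If \<open>f\<close> agrees on \<open>(1 + t) u - t v\<close> and \<open>(1 + s) u' - s v'\<close>, it agrees on \<open>(1 + t) u + s v'\<close> and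
  \<open>(1 + s) u' + t v\<close>. These are points of \<open>S\<close> scaled by the same positive factor \<open>1 + t + s\<close>, so
  injectivity on \<open>S\<close> applies.
\<close>

lemma inj_on_affine_hull:
  fixes S :: "'a::real_vector set" and f :: "'a \<Rightarrow> 'b::real_vector"
  assumes "linear f" "convex S" "inj_on f S"
  shows "inj_on f (affine hull S)"
proof (rule inj_onI)
  interpret linear f by fact
  fix p q
  assume pq: "p \<in> affine hull S" "q \<in> affine hull S" and eq: "f p = f q"
  obtain u v t where p: "u \<in> S" "v \<in> S" "0 \<le> t" "p = (1 + t) *\<^sub>R u - t *\<^sub>R v"
    using affine_hull_convex_extrapolation[OF assms(2) pq(1)] .
  obtain u' v' s where q: "u' \<in> S" "v' \<in> S" "0 \<le> s" "q = (1 + s) *\<^sub>R u' - s *\<^sub>R v'"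
    using affine_hull_convex_extrapolation[OF assms(2) pq(2)] .
  obtain w where w: "w \<in> S" "(1 + t) *\<^sub>R u + s *\<^sub>R v' = (1 + t + s) *\<^sub>R w"
    using convex_nonneg_combination[OF assms(2) p(1) q(2), of "1 + t" s] p(3) q(3) by auto
  obtain w' where w': "w' \<in> S" "(1 + s) *\<^sub>R u' + t *\<^sub>R v = (1 + s + t) *\<^sub>R w'"
    using convex_nonneg_combination[OF assms(2) q(1) p(2), of "1 + s" t] p(3) q(3) by auto
  have pw: "p + t *\<^sub>R v + s *\<^sub>R v' = (1 + t + s) *\<^sub>R w"
    using p(4) w(2) by simp
  have qw: "q + t *\<^sub>R v + s *\<^sub>R v' = (1 + t + s) *\<^sub>R w'"
    using q(4) w'(2) by (simp add: ac_simps)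
  have "f (p + t *\<^sub>R v + s *\<^sub>R v') = f (q + t *\<^sub>R v + s *\<^sub>R v')"
    using eq by (simp add: add)
  then have "(1 + t + s) *\<^sub>R f w = (1 + t + s) *\<^sub>R f w'"
    unfolding pw qw by (simp only: scaleR)
  then have "f w = f w'" using p(3) q(3) by simp
  then have "w = w'" using assms(3) w(1) w'(1) by (simp add: inj_on_eq_iff)
  then show "p = q" using pw qw by (metis add_right_cancel)
qed

text \<open>
  Affine maps as the maps that preserve affine combinations. From such a \<open>G\<close> the linear part is
  recovered as \<open>v \<mapsto> G (x0 + v) - G x0\<close>.
\<close>

lemma affine_map_on_iff_affine_combinations:
  fixes G :: "'a::real_vector \<Rightarrow> 'b::real_vector"
  assumes "affine A" "A \<noteq> {}"
  shows "affine_map_on A G \<longleftrightarrow>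
    (\<forall>x\<in>A. \<forall>y\<in>A. \<forall>a b. a + b = 1 \<longrightarrow> G (a *\<^sub>R x + b *\<^sub>R y) = a *\<^sub>R G x + b *\<^sub>R G y)"
    (is "_ \<longleftrightarrow> ?comb")
proof
  assume "affine_map_on A G"
  then obtain x0 L c where x0: "x0 \<in> A" and L: "linear_map_on (par A x0) L"
    and G: "\<And>x. x \<in> A \<Longrightarrow> G x = L (x - x0) + c"
    unfolding affine_map_on_def affine_map_at_def by blast
  show ?comb
  proof (intro ballI allI impI)
    fix x y and a b :: real
    assume xy: "x \<in> A" "y \<in> A" and ab: "a + b = 1"
    have b: "b = 1 - a" using ab by simp
    have mem: "a *\<^sub>R x + b *\<^sub>R y \<in> A" using assms(1) xy ab by (simp add: affine_def)
    have par: "x - x0 \<in> par A x0" "y - x0 \<in> par A x0"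
      using xy by (simp_all add: par_def)
    then have "a *\<^sub>R (x - x0) \<in> par A x0" "b *\<^sub>R (y - x0) \<in> par A x0"
      using subspace_par[OF assms(1) x0] by (simp_all add: subspace_scale)
    then have "L (a *\<^sub>R (x - x0) + b *\<^sub>R (y - x0)) = a *\<^sub>R L (x - x0) + b *\<^sub>R L (y - x0)"
      using L par unfolding linear_map_on_def by simp
    moreover have "a *\<^sub>R x + b *\<^sub>R y - x0 = a *\<^sub>R (x - x0) + b *\<^sub>R (y - x0)"
      by (simp add: b algebra_simps)
    ultimately show "G (a *\<^sub>R x + b *\<^sub>R y) = a *\<^sub>R G x + b *\<^sub>R G y"
      unfolding G[OF mem] G[OF xy(1)] G[OF xy(2)] by (simp add: b algebra_simps)
  qed
next
  assume comb: ?comb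
  obtain x0 where x0: "x0 \<in> A" using assms(2) by blast
  define L where "L v = G (x0 + v) - G x0" for v
  have par: "v \<in> par A x0 \<longleftrightarrow> x0 + v \<in> A" for v
    by (force simp: par_def image_iff)
  have scale: "L (c *\<^sub>R v) = c *\<^sub>R L v" if "v \<in> par A x0" for c v
  proof -
    have "x0 + c *\<^sub>R v = (1 - c) *\<^sub>R x0 + c *\<^sub>R (x0 + v)"
      by (simp add: algebra_simps)
    also have "G \<dots> = (1 - c) *\<^sub>R G x0 + c *\<^sub>R G (x0 + v)"
      using comb x0 that by (simp add: par)
    finally show ?thesis by (simp add: L_def algebra_simps)
  qed
  have plus: "L (u + v) = L u + L v" if "u \<in> par A x0" "v \<in> par A x0" for u v
  proof -
    \<comment> \<open>The midpoint of \<open>x0 + u\<close> and \<open>x0 + v\<close> gives half of the sum; homogeneity removes the half.\<close>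
    have "x0 + (1/2) *\<^sub>R (u + v) = (1/2) *\<^sub>R (x0 + u) + (1/2) *\<^sub>R (x0 + v)"
      by (simp add: algebra_simps flip: scaleR_add_left)
    also have "G \<dots> = (1/2) *\<^sub>R G (x0 + u) + (1/2) *\<^sub>R G (x0 + v)"
      using comb that by (simp add: par)
    finally have "L ((1/2) *\<^sub>R (u + v)) = (1/2) *\<^sub>R (L u + L v)"
      by (simp add: L_def algebra_simps flip: scaleR_add_left)
    moreover have "u + v \<in> par A x0"
      using subspace_par[OF assms(1) x0] that by (simp add: subspace_add)
    ultimately show ?thesis using scale by simp
  qed
  have "affine_map_at A x0 G"
    unfolding affine_map_at_def linear_map_on_def
    using plus scale by (intro exI[of _ L] exI[of _ "G x0"]) (auto simp: L_def)
  then show "affine_map_on A G"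
    using affine_map_on_iff[OF assms(1) x0] by blast
qed

lemma affine_map_on_if_affine_graph:
  fixes G :: "'a::real_vector \<Rightarrow> 'b::real_vector"
  assumes "affine A" "A \<noteq> {}" "affine ((\<lambda>x. (x, G x)) ` A)"
  shows "affine_map_on A G"
  unfolding affine_map_on_iff_affine_combinations[OF assms(1,2)]
proof (intro ballI allI impI)
  fix x y and a b :: real
  assume "x \<in> A" "y \<in> A" "a + b = 1"
  then have "a *\<^sub>R (x, G x) + b *\<^sub>R (y, G y) \<in> (\<lambda>x. (x, G x)) ` A"
    using assms(3) unfolding affine_def by blast
  then show "G (a *\<^sub>R x + b *\<^sub>R y) = a *\<^sub>R G x + b *\<^sub>R G y" by auto
qed

lemma K_epi_zero_eq_graph: "K_epi {0} D F = (\<lambda>x. (x, F x)) ` D"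
  by (auto simp: K_epi_def)

theorem proposition18:
  fixes D :: "'a::real_inner set"
    and F :: "'a \<Rightarrow> 'b::real_inner"
  assumes "finite_dimensional TYPE('a)"
    and "finite_dimensional TYPE('b)"
    and "D \<noteq> {}"
    and "convex D"
  shows "K_convex_on {0} D F \<longleftrightarrow>
    (\<exists>G :: 'a \<Rightarrow> 'b. affine_map_on (affine hull D) G \<and> (\<forall>x\<in>D. F x = G x))"
proof
  let ?A = "affine hull D" and ?S = "(\<lambda>x. (x, F x)) ` D"
  let ?T = "affine hull ?S"
  assume "K_convex_on {0} D F"
  then have "convex ?S" by (simp add: K_convex_on_def K_epi_zero_eq_graph)
  then have inj: "inj_on fst ?T"
    by (intro inj_on_affine_hull) (auto simp: linear_fst inj_on_def)
  have proj: "fst ` ?T = ?A"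
    using affine_hull_linear_image[OF bounded_linear_fst, of ?S] by (simp add: image_image)
  define G where "G x = snd (inv_into ?T fst x)" for x
  have G: "G (fst p) = snd p" if "p \<in> ?T" for p
    using that inj by (simp add: G_def)
  have "(\<lambda>x. (x, G x)) ` ?A = (\<lambda>p. (fst p, G (fst p))) ` ?T"
    by (simp add: proj[symmetric] image_image)
  also have "\<dots> = ?T" using G by simp
  finally have "affine ((\<lambda>x. (x, G x)) ` ?A)" by simp
  then have "affine_map_on ?A G"
    using assms(3) by (intro affine_map_on_if_affine_graph) auto
  moreover have "F x = G x" if "x \<in> D" for x
    using G[of "(x, F x)"] that by (simp add: hull_inc)
  ultimately show "\<exists>G. affine_map_on ?A G \<and> (\<forall>x\<in>D. F x = G x)" by blast
next
  let ?A = "affine hull D"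
  assume "\<exists>G. affine_map_on ?A G \<and> (\<forall>x\<in>D. F x = G x)"
  then obtain G where G: "affine_map_on ?A G" and FG: "\<And>x. x \<in> D \<Longrightarrow> F x = G x" by blast
  have "?A \<noteq> {}" using assms(3) by simp
  note comb = G[unfolded affine_map_on_iff_affine_combinations[OF affine_affine_hull this]]
  have "convex ((\<lambda>x. (x, F x)) ` D)"
  proof (rule convexI)
    fix p q and a b :: real
    assume "p \<in> (\<lambda>x. (x, F x)) ` D" "q \<in> (\<lambda>x. (x, F x)) ` D"
      and ab: "0 \<le> a" "0 \<le> b" "a + b = 1"
    then obtain x y where xy: "x \<in> D" "y \<in> D" "p = (x, F x)" "q = (y, F y)" by blast
    have mem: "a *\<^sub>R x + b *\<^sub>R y \<in> D" using assms(4) xy(1,2) ab by (simp add: convexD)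
    have "F (a *\<^sub>R x + b *\<^sub>R y) = a *\<^sub>R F x + b *\<^sub>R F y"
      using comb xy(1,2) ab mem by (simp add: FG hull_inc)
    then show "a *\<^sub>R p + b *\<^sub>R q \<in> (\<lambda>x. (x, F x)) ` D"
      using mem xy(3,4) by (simp add: image_iff)
  qed
  then show "K_convex_on {0} D F" by (simp add: K_convex_on_def K_epi_zero_eq_graph)
qed

end
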